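(* Let $R$ be an integral domain that is different from its quotient field $K$. The following are equivalent. (1) $R$ is dually compact (DC). (2) $A_v$ is a $v$-ideal of finite type for every $A\in F(R)$. (3) $A^{-1}$ is a $v$-ideal of finite type for each $A\in F(R)$. (4) $A^{-1}$ is a $v$-ideal of finite type for each nonzero integral ideal $A$ of $R$. (5) $A_v$ is a $v$-ideal of finite type for each nonzero integral ideal $A$ of $R$. (6) Every divisorial ideal of $R$ is expressible as a finite intersection of principal fractional ideals. (7) There is a star operation $\star$ on $R$ such that for each $A\in F(R)$ the ideal $A^{\star}$ is a $v$-ideal of finite type. (8) There is a star operation $\star$ on $R$ such that for each $A\in F(R)$ the ideal $A^{\star}$ is a finite intersection of principal ideals from $F(R)$.
   Context: $F(R)$ denotes the set of nonzero fractional ideals of $R$, and $(a)=aR$ for $a\in K$. For $A\in F(R)$, $A^{-1}=\{x\in K: xA\subseteq R\}$ and $A_v=(A^{-1})^{-1}$. An ideal $A\in F(R)$ is divisorial (a $v$-ideal) if $A=A_v$; it is a $v$-ideal of finite type if $A=(s_1,\dots,s_r)_v$ for some $s_1,\dots,s_r\in K\setminus\{0\}$. A (nonempty) set $\{a_\alpha\}_{\alpha\in I}\subseteq K\setminus\{0\}$ is called allowable if $\bigcap_{\alpha\in I}(a_\alpha)\neq(0)$. $R$ is dually compact (DC; a DCD) if for every allowable set $\{a_\alpha\}_{\alpha\in I}\subseteq K\setminus\{0\}$ there is a finite set $\{x_1,\dots,x_n\}\subseteq K\setminus\{0\}$ with $\bigcap_{\alpha\in I}(a_\alpha)=(x_1)\cap\dots\cap(x_n)$.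 A star operation on $R$ is a function $A\mapsto A^{\star}$ from $F(R)$ to $F(R)$ such that for all $A,B\in F(R)$ and $a\in K\setminus\{0\}$: (i) $(a)^{\star}=(a)$ and $(aA)^{\star}=aA^{\star}$; (ii) $A\subseteq A^{\star}$, and $A\subseteq B$ implies $A^{\star}\subseteq B^{\star}$; (iii) $(A^{\star})^{\star}=A^{\star}$. *)

theory Defs
  imports "HOL-Computational_Algebra.Computational_Algebra"
begin

text \<open>
  An integral domain \<open>R\<close> is a type \<open>'a\<close> of class \<^class>\<open>idom\<close>, and its quotient field \<open>K\<close> is
  \<open>'a fract\<close>. Ideals, integral ones included, are subsets of \<open>K\<close>, with \<open>R\<close> identified with
  the following subring.
\<close>

abbreviation base_ring :: "'a::idom fract set" where
  "base_ring \<equiv> range to_fract"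

text \<open>
  \<open>K\<close> as an \<open>R\<close>-module: \<open>K_module.subspace\<close> says ``is an \<open>R\<close>-submodule of \<open>K\<close>'' and
  \<open>K_module.span S\<close> is the \<open>R\<close>-submodule generated by \<open>S\<close>.
\<close>

global_interpretation K_module: module "\<lambda>(r::'a::idom) (x::'a fract). to_fract r * x"
  by unfold_locales (simp_all add: algebra_simps)

definition fractional_ideals :: "'a::idom fract set set" where
  "fractional_ideals =
     {A. K_module.subspace A \<and> A \<noteq> {0} \<and> (\<exists>d. d \<noteq> 0 \<and> (\<forall>x\<in>A. to_fract d * x \<in> base_ring))}"

definition integral_ideals :: "'a::idom fract set set" where
  "integral_ideals = {A. K_module.subspace A \<and> A \<noteq> {0} \<and> A \<subseteq> base_ring}"

definition principal :: "'a::idom fract \<Rightarrow> 'a fract set" where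
  "principal a = (*) a ` base_ring"

definition ideal_inverse :: "'a::idom fract set \<Rightarrow> 'a fract set" where
  "ideal_inverse A = {x. (*) x ` A \<subseteq> base_ring}"

definition v_closure :: "'a::idom fract set \<Rightarrow> 'a fract set" where
  "v_closure A = ideal_inverse (ideal_inverse A)"

definition divisorial :: "'a::idom fract set \<Rightarrow> bool" where
  "divisorial A \<longleftrightarrow> A \<in> fractional_ideals \<and> A = v_closure A"

definition v_finite_type :: "'a::idom fract set \<Rightarrow> bool" where
  "v_finite_type A \<longleftrightarrow> A \<in> fractional_ideals \<and>
     (\<exists>S. finite S \<and> S \<noteq> {} \<and> 0 \<notin> S \<and> A = v_closure (K_module.span S))"

definition finite_intersection_of_principals :: "'a::idom fract set \<Rightarrow> bool" where
  "finite_intersection_of_principals A \<longleftrightarrow>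
     (\<exists>X. finite X \<and> X \<noteq> {} \<and> 0 \<notin> X \<and> A = (\<Inter>x\<in>X. principal x))"

definition allowable :: "'a::idom fract set \<Rightarrow> bool" where
  "allowable S \<longleftrightarrow> S \<noteq> {} \<and> 0 \<notin> S \<and> (\<Inter>a\<in>S. principal a) \<noteq> {0}"

definition dually_compact :: "'a::idom itself \<Rightarrow> bool" where
  "dually_compact _ \<longleftrightarrow>
     (\<forall>S::'a fract set. allowable S \<longrightarrow> finite_intersection_of_principals (\<Inter>a\<in>S. principal a))"

text \<open>Values of a star operation outside \<open>F(R)\<close> are irrelevant and left unconstrained.\<close>

definition star_operation :: "('a::idom fract set \<Rightarrow> 'a fract set) \<Rightarrow> bool" where
  "star_operation star \<longleftrightarrow>
     star \<in> fractional_ideals \<rightarrow> fractional_ideals \<and>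
     (\<forall>a. a \<noteq> 0 \<longrightarrow> star (principal a) = principal a) \<and>
     (\<forall>a. \<forall>A\<in>fractional_ideals. a \<noteq> 0 \<longrightarrow> star ((*) a ` A) = (*) a ` star A) \<and>
     (\<forall>A\<in>fractional_ideals. A \<subseteq> star A) \<and>
     (\<forall>A\<in>fractional_ideals. \<forall>B\<in>fractional_ideals. A \<subseteq> B \<longrightarrow> star A \<subseteq> star B) \<and>
     (\<forall>A\<in>fractional_ideals. star (star A) = star A)"

end

theory Submission
  imports Defs
begin

text \<open>
  For \<open>A\<close> fractional, \<open>A\<^sup>-\<^sup>1\<close> is the intersection of the principal ideals \<open>(1/a)\<close> with
  \<open>0 \<noteq> a \<in> A\<close>, and every intersection of an allowable set arises in this way. The map
  \<open>A \<mapsto> A\<^sup>-\<^sup>1\<close> is an antitone Galois connection, so it exchanges \<open>v\<close>-ideals of finite type with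
  finite intersections of principal ideals. Dual compactness thus says that every \<open>A\<^sup>-\<^sup>1\<close> is a
  finite intersection of principal ideals. Scaling passes between integral and fractional ideals.
  Finally \<open>A\<^sup>\<star> \<subseteq> A\<^sub>v\<close> for every star operation, because \<open>A\<^sub>v\<close> is the intersection of the
  principal ideals containing \<open>A\<close>, so a star operation with divisorial values is the
  \<open>v\<close>-operation.
\<close>

section \<open>Arithmetic in \<open>R\<close> and membership tests\<close>

lemma base_ring_add: "x \<in> base_ring \<Longrightarrow> y \<in> base_ring \<Longrightarrow> x + y \<in> base_ring"
  by (metis (no_types, lifting) imageE rangeI to_fract_add)

lemma base_ring_mult: "x \<in> base_ring \<Longrightarrow> y \<in> base_ring \<Longrightarrow> x * y \<in> base_ring"
  by (metis (no_types, lifting) imageE rangeI to_fract_mult)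

lemma zero_in_base_ring: "0 \<in> base_ring"
  by (metis rangeI to_fract_0)

lemma fract_denominator:
  obtains p q where "q \<noteq> 0" "to_fract q * x = to_fract p"
proof -
  obtain a b where "x = Fract a b" "b \<noteq> 0" by (cases x) blast
  then have "to_fract b * x = to_fract a" by (simp add: to_fract_def eq_fract)
  with \<open>b \<noteq> 0\<close> that show ?thesis by blast
qed

lemma in_ideal_inverse_iff: "x \<in> ideal_inverse A \<longleftrightarrow> (\<forall>a\<in>A. x * a \<in> base_ring)"
  unfolding ideal_inverse_def by blast

lemma in_principal_iff: "a \<noteq> 0 \<Longrightarrow> x \<in> principal a \<longleftrightarrow> x * inverse a \<in> base_ring"
proof
  assume "a \<noteq> 0" "x * inverse a \<in> base_ring"
  moreover have "x = a * (x * inverse a)" using \<open>a \<noteq> 0\<close> by simp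
  ultimately show "x \<in> principal a" unfolding principal_def by blast
qed (auto simp: principal_def field_simps)

section \<open>The Galois connection given by the inverse\<close>

lemma subspace_ideal_inverse: "K_module.subspace (ideal_inverse A)"
  unfolding K_module.subspace_def
  by (auto simp: in_ideal_inverse_iff distrib_right mult.assoc zero_in_base_ring intro: base_ring_add base_ring_mult)

lemma ideal_inverse_antimono: "A \<subseteq> B \<Longrightarrow> ideal_inverse B \<subseteq> ideal_inverse A"
  unfolding ideal_inverse_def by blast

lemma v_closure_mono: "A \<subseteq> B \<Longrightarrow> v_closure A \<subseteq> v_closure B"
  unfolding v_closure_def by (intro ideal_inverse_antimono)

lemma subset_v_closure: "A \<subseteq> v_closure A"
  unfolding v_closure_def by (auto simp: in_ideal_inverse_iff) (metis mult.commute)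

text \<open>Three inverses collapse to one: one inclusion comes from reversing
  \<open>A \<subseteq> v_closure A\<close>, the other from applying the same inclusion to
  \<open>ideal_inverse A\<close>.\<close>

lemma ideal_inverse_v_closure [simp]: "ideal_inverse (v_closure A) = ideal_inverse A"
  using ideal_inverse_antimono[OF subset_v_closure, of A] subset_v_closure[of "ideal_inverse A"]
  by (simp add: v_closure_def)

lemma v_closure_ideal_inverse [simp]: "v_closure (ideal_inverse A) = ideal_inverse A"
  using ideal_inverse_v_closure[of A] by (simp add: v_closure_def)

lemma v_closure_idem: "v_closure (v_closure A) = v_closure A"
  by (metis v_closure_def v_closure_ideal_inverse)

text \<open>The submodule \<open>v_closure S\<close> contains \<open>S\<close>, hence its span, and
  has the same inverse as \<open>S\<close>. This allows generating sets to replace ideals from here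
  on.\<close>

lemma ideal_inverse_span [simp]: "ideal_inverse (K_module.span S) = ideal_inverse S"
proof
  show "ideal_inverse (K_module.span S) \<subseteq> ideal_inverse S"
    by (intro ideal_inverse_antimono K_module.span_superset)
  have "K_module.span S \<subseteq> v_closure S"
    unfolding v_closure_def
    by (intro K_module.span_minimal subspace_ideal_inverse)
       (use subset_v_closure in \<open>simp add: v_closure_def\<close>)
  then show "ideal_inverse S \<subseteq> ideal_inverse (K_module.span S)"
    using ideal_inverse_antimono ideal_inverse_v_closure by metis
qed

lemma v_closure_span [simp]: "v_closure (K_module.span S) = v_closure S"
  by (simp add: v_closure_def)

section \<open>Scaling, and intersections of principal ideals as inverses\<close>

lemma ideal_inverse_scale:
  assumes "a \<noteq> 0"
  shows "ideal_inverse ((*) a ` A) = (*) (inverse a) ` ideal_inverse A"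
proof
  show "ideal_inverse ((*) a ` A) \<subseteq> (*) (inverse a) ` ideal_inverse A"
  proof
    fix x assume "x \<in> ideal_inverse ((*) a ` A)"
    then have "a * x \<in> ideal_inverse A" by (simp add: in_ideal_inverse_iff ac_simps)
    moreover have "x = inverse a * (a * x)" using assms by simp
    ultimately show "x \<in> (*) (inverse a) ` ideal_inverse A" by blast
  qed
qed (use assms in \<open>auto simp: in_ideal_inverse_iff field_simps\<close>)

lemma v_closure_scale: "a \<noteq> 0 \<Longrightarrow> v_closure ((*) a ` A) = (*) a ` v_closure A"
  by (simp add: v_closure_def ideal_inverse_scale)

lemma Inter_principal_eq_ideal_inverse:
  "0 \<notin> S \<Longrightarrow> (\<Inter>a\<in>S. principal a) = ideal_inverse (inverse ` S)"
  by (auto simp: in_ideal_inverse_iff) (metis in_principal_iff)+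

lemma principal_eq_ideal_inverse: "a \<noteq> 0 \<Longrightarrow> principal a = ideal_inverse {inverse a}"
  using Inter_principal_eq_ideal_inverse[of "{a}"] by simp

text \<open>The element 0 imposes no condition on a multiplier. Allowable sets must avoid 0, whereas
  every ideal contains it.\<close>

lemma ideal_inverse_remove_zero: "ideal_inverse (A - {0}) = ideal_inverse A"
  by (auto simp: in_ideal_inverse_iff) (metis DiffI singletonD mult_zero_right zero_in_base_ring)

text \<open>Inverting the generators turns the intersection into the inverse of a finite set, the
  form to which the Galois connection applies.\<close>

lemma finite_intersection_of_principals_iff:
  "finite_intersection_of_principals A \<longleftrightarrow>
     (\<exists>X. finite X \<and> X \<noteq> {} \<and> 0 \<notin> X \<and> A = ideal_inverse X)"
proof
  assume "finite_intersection_of_principals A"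
  then obtain X where "finite X" "X \<noteq> {}" "0 \<notin> X" "A = (\<Inter>x\<in>X. principal x)"
    unfolding finite_intersection_of_principals_def by blast
  then show "\<exists>X. finite X \<and> X \<noteq> {} \<and> 0 \<notin> X \<and> A = ideal_inverse X"
    by (intro exI[of _ "inverse ` X"]) (auto simp: Inter_principal_eq_ideal_inverse)
next
  assume "\<exists>X. finite X \<and> X \<noteq> {} \<and> 0 \<notin> X \<and> A = ideal_inverse X"
  then obtain X where X: "finite X" "X \<noteq> {}" "0 \<notin> X" "A = ideal_inverse X" by blast
  have "0 \<notin> inverse ` X" using X(3) by auto
  then have "A = (\<Inter>x\<in>inverse ` X. principal x)"
    using Inter_principal_eq_ideal_inverse[of "inverse ` X"] X(4)
    by (simp only: image_image inverse_inverse_eq image_ident not_False_eq_True)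
  with X \<open>0 \<notin> inverse ` X\<close> show "finite_intersection_of_principals A"
    unfolding finite_intersection_of_principals_def by (intro exI[of _ "inverse ` X"]) simp
qed

lemma finite_intersection_of_principals_scale:
  assumes "a \<noteq> 0" "finite_intersection_of_principals A"
  shows "finite_intersection_of_principals ((*) a ` A)"
proof -
  obtain X where X: "finite X" "X \<noteq> {}" "0 \<notin> X" "A = ideal_inverse X"
    using assms by (auto simp: finite_intersection_of_principals_iff)
  then have "(*) a ` A = ideal_inverse ((*) (inverse a) ` X)"
    using assms by (simp add: ideal_inverse_scale)
  moreover have "0 \<notin> (*) (inverse a) ` X" using X assms by auto
  ultimately show ?thesis
    using X unfolding finite_intersection_of_principals_iff
    by (intro exI[of _ "(*) (inverse a) ` X"]) simp
qed

lemma finite_intersection_of_principals_scale_iff: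
  assumes "a \<noteq> 0"
  shows "finite_intersection_of_principals ((*) a ` A) \<longleftrightarrow> finite_intersection_of_principals A"
proof
  assume "finite_intersection_of_principals ((*) a ` A)"
  from finite_intersection_of_principals_scale[OF _ this, of "inverse a"] assms
  show "finite_intersection_of_principals A" by (simp add: image_image mult.assoc[symmetric])
qed (use assms finite_intersection_of_principals_scale in blast)

section \<open>Construction of fractional ideals\<close>

lemma span_in_fractional_ideals:
  assumes "a \<in> S" "a \<noteq> 0" "x \<in> ideal_inverse S" "x \<noteq> 0"
  shows "K_module.span S \<in> fractional_ideals"
proof -
  obtain p q where pq: "q \<noteq> 0" "to_fract q * x = to_fract p" by (rule fract_denominator)
  \<comment> \<open>The numerator \<open>p\<close> of \<open>x\<close> serves as common denominator,
    since \<open>p * y = q * (x * y)\<close>.\<close>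
  have "p \<noteq> 0" using pq assms(4) by auto
  moreover have "to_fract p * y \<in> base_ring" if "y \<in> K_module.span S" for y
  proof -
    have "x * y \<in> base_ring" using that assms(3) ideal_inverse_span in_ideal_inverse_iff by metis
    then have "to_fract q * (x * y) \<in> base_ring" by (rule base_ring_mult[OF rangeI])
    then show ?thesis by (simp add: pq(2)[symmetric] mult.assoc)
  qed
  moreover have "K_module.span S \<noteq> {0}" using assms(1,2) K_module.span_base by blast
  ultimately show ?thesis unfolding fractional_ideals_def by auto
qed

lemma fractional_ideal_nonzero_elem:
  assumes "A \<in> fractional_ideals"
  obtains a where "a \<in> A" "a \<noteq> 0"
  using assms K_module.subspace_0 unfolding fractional_ideals_def by blast

lemma fractional_ideal_inverse_nonzero_elem:
  assumes "A \<in> fractional_ideals"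
  obtains d where "d \<noteq> 0" "to_fract d \<in> ideal_inverse A"
  using assms unfolding fractional_ideals_def in_ideal_inverse_iff by blast

lemma ideal_inverse_in_fractional_ideals:
  assumes "A \<in> fractional_ideals"
  shows "ideal_inverse A \<in> fractional_ideals"
proof -
  obtain a where a: "a \<in> A" "a \<noteq> 0" by (rule fractional_ideal_nonzero_elem[OF assms])
  obtain d where d: "d \<noteq> 0" "to_fract d \<in> ideal_inverse A"
    by (rule fractional_ideal_inverse_nonzero_elem[OF assms])
  \<comment> \<open>The roles are exchanged: \<open>to_fract d\<close> is the nonzero element of the
    inverse, and \<open>a\<close>, which lies in \<open>v_closure A\<close>, is the nonzero
    multiplier bounding it.\<close>
  have "K_module.span (ideal_inverse A) \<in> fractional_ideals"
    using d a subset_v_closure[of A]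
    by (intro span_in_fractional_ideals[of "to_fract d" _ a]) (auto simp: v_closure_def)
  moreover have "K_module.span (ideal_inverse A) = ideal_inverse A"
    by (simp add: K_module.span_eq_iff subspace_ideal_inverse)
  ultimately show ?thesis by simp
qed

lemma v_closure_in_fractional_ideals:
  "A \<in> fractional_ideals \<Longrightarrow> v_closure A \<in> fractional_ideals"
  by (simp add: v_closure_def ideal_inverse_in_fractional_ideals)

lemma principal_in_fractional_ideals:
  assumes "a \<noteq> 0"
  shows "principal a \<in> fractional_ideals"
proof -
  have one: "1 \<in> base_ring" by (metis rangeI to_fract_1)
  have "K_module.span {inverse a} \<in> fractional_ideals"
    using assms one
    by (intro span_in_fractional_ideals[of "inverse a" _ a]) (auto simp: in_ideal_inverse_iff)
  from ideal_inverse_in_fractional_ideals[OF this] show ?thesis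
    using assms by (simp add: principal_eq_ideal_inverse)
qed

lemma scale_fractional_ideal_integral:
  assumes "A \<in> fractional_ideals"
  obtains d where "d \<noteq> 0" "(*) (to_fract d) ` A \<in> integral_ideals"
proof -
  obtain d where d: "d \<noteq> 0" "to_fract d \<in> ideal_inverse A"
    by (rule fractional_ideal_inverse_nonzero_elem[OF assms])
  obtain a where a: "a \<in> A" "a \<noteq> 0" by (rule fractional_ideal_nonzero_elem[OF assms])
  \<comment> \<open>Multiplication by \<open>d\<close> is \<open>R\<close>-linear, so it maps
    submodules to submodules.\<close>
  interpret mult: module_hom "\<lambda>r x. to_fract r * x" "\<lambda>r x. to_fract r * x" "(*) (to_fract d)"
    by unfold_locales (simp_all add: algebra_simps)
  have "K_module.subspace ((*) (to_fract d) ` A)"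
    using assms by (intro mult.subspace_image) (simp add: fractional_ideals_def)
  moreover have "to_fract d * a \<noteq> 0" using d a by simp
  then have "(*) (to_fract d) ` A \<noteq> {0}" using a by blast
  moreover have "(*) (to_fract d) ` A \<subseteq> base_ring" using d by (simp add: ideal_inverse_def)
  ultimately show ?thesis using that d unfolding integral_ideals_def by blast
qed

lemma integral_ideals_subset: "integral_ideals \<subseteq> fractional_ideals"
proof
  fix A :: "'a fract set" assume "A \<in> integral_ideals"
  then show "A \<in> fractional_ideals"
    unfolding integral_ideals_def fractional_ideals_def by (auto intro!: exI[of _ 1])
qed

section \<open>Finite type and dual compactness\<close>

lemma v_finite_type_iff:
  "v_finite_type A \<longleftrightarrow>
     A \<in> fractional_ideals \<and> (\<exists>S. finite S \<and> S \<noteq> {} \<and> 0 \<notin> S \<and> A = v_closure S)"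
  by (simp add: v_finite_type_def)

text \<open>\<open>v_closure A\<close> and \<open>ideal_inverse A\<close> determine each other, so
  one finite set \<open>S\<close> witnesses both sides.\<close>

lemma v_finite_type_v_closure_iff:
  assumes "A \<in> fractional_ideals"
  shows "v_finite_type (v_closure A) \<longleftrightarrow> finite_intersection_of_principals (ideal_inverse A)"
proof -
  have "v_closure A = v_closure S \<longleftrightarrow> ideal_inverse A = ideal_inverse S" for S
    by (metis ideal_inverse_v_closure v_closure_def)
  then show ?thesis
    using v_closure_in_fractional_ideals[OF assms]
    by (simp add: v_finite_type_iff finite_intersection_of_principals_iff)
qed

lemma v_finite_type_ideal_inverse_iff:
  assumes "A \<in> fractional_ideals"
  shows "v_finite_type (ideal_inverse A) \<longleftrightarrow> finite_intersection_of_principals (v_closure A)"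
  using v_finite_type_v_closure_iff[OF ideal_inverse_in_fractional_ideals[OF assms]]
  by (metis v_closure_def v_closure_ideal_inverse)

lemma dually_compact_iff:
  "dually_compact TYPE('a::idom) \<longleftrightarrow>
     (\<forall>A \<in> (fractional_ideals :: 'a fract set set).
        finite_intersection_of_principals (ideal_inverse A))"
proof (intro iffI ballI)
  fix A :: "'a fract set"
  assume dc: "dually_compact TYPE('a)" and A: "A \<in> fractional_ideals"
  \<comment> \<open>With this choice \<open>principal\<close> runs over the ideals
    \<open>(1/a)\<close> for nonzero \<open>a\<close> in \<open>A\<close>, whose intersection is
    \<open>ideal_inverse A\<close>.\<close>
  define S where "S = inverse ` (A - {0})"
  have "0 \<notin> S" by (auto simp: S_def)
  then have S: "(\<Inter>a\<in>S. principal a) = ideal_inverse A"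
    by (simp only: Inter_principal_eq_ideal_inverse not_False_eq_True)
       (simp add: S_def image_image ideal_inverse_remove_zero)
  have "S \<noteq> {}" using fractional_ideal_nonzero_elem[OF A] by (auto simp: S_def)
  moreover have "ideal_inverse A \<noteq> {0}"
    using ideal_inverse_in_fractional_ideals[OF A] by (simp add: fractional_ideals_def)
  ultimately have "allowable S" using S \<open>0 \<notin> S\<close> by (simp add: allowable_def)
  then show "finite_intersection_of_principals (ideal_inverse A)"
    using dc S unfolding dually_compact_def by metis
next
  assume fip: "\<forall>A \<in> (fractional_ideals :: 'a fract set set).
    finite_intersection_of_principals (ideal_inverse A)"
  show "dually_compact TYPE('a)"
    unfolding dually_compact_def
  proof (intro allI impI)
    fix S :: "'a fract set" assume S: "allowable S"
    then have eq: "(\<Inter>a\<in>S. principal a) = ideal_inverse (inverse ` S)"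
      by (simp add: allowable_def Inter_principal_eq_ideal_inverse)
    have "0 \<in> ideal_inverse (inverse ` S)"
      by (simp add: in_ideal_inverse_iff zero_in_base_ring)
    then obtain x where x: "x \<in> ideal_inverse (inverse ` S)" "x \<noteq> 0"
      using S eq unfolding allowable_def by (metis (no_types, lifting) insert_absorb singletonI
        subsetI subset_singletonD insert_not_empty empty_iff)
    obtain s where "s \<in> S" "s \<noteq> 0" using S unfolding allowable_def by (metis ex_in_conv)
    with x have "K_module.span (inverse ` S) \<in> fractional_ideals"
      by (intro span_in_fractional_ideals[of "inverse s" _ x]) auto
    with fip have "finite_intersection_of_principals (ideal_inverse (inverse ` S))"
      by (metis ideal_inverse_span)
    then show "finite_intersection_of_principals (\<Inter>a\<in>S. principal a)" by (simp only: eq)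
  qed
qed

section \<open>Star operations\<close>

lemma star_operation_v_closure: "star_operation v_closure"
  unfolding star_operation_def
  by (auto simp: v_closure_in_fractional_ideals principal_eq_ideal_inverse v_closure_scale
      v_closure_idem dest: subsetD[OF subset_v_closure] subsetD[OF v_closure_mono])

lemma star_operation_subset_v_closure:
  assumes star: "star_operation star" and A: "A \<in> fractional_ideals"
  shows "star A \<subseteq> v_closure A"
proof
  fix x assume x: "x \<in> star A"
  have "x * y \<in> base_ring" if y: "y \<in> ideal_inverse A" for y
  proof (cases "y = 0")
    case False
    \<comment> \<open>For nonzero \<open>y\<close>, the condition \<open>y * A \<subseteq> R\<close>
      says that \<open>A\<close> lies in \<open>(1/y)\<close>, and star operations fix principal
      ideals.\<close>
    have "A \<subseteq> principal (inverse y)"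
      using y False by (auto simp: in_principal_iff in_ideal_inverse_iff mult.commute)
    moreover have "principal (inverse y) \<in> fractional_ideals"
      using False by (simp add: principal_in_fractional_ideals)
    ultimately have "star A \<subseteq> star (principal (inverse y))"
      using star A unfolding star_operation_def by blast
    also have "\<dots> = principal (inverse y)"
      using star False unfolding star_operation_def by simp
    finally show ?thesis using x False by (auto simp: in_principal_iff)
  qed (simp add: zero_in_base_ring)
  then show "x \<in> v_closure A" by (simp add: v_closure_def in_ideal_inverse_iff)
qed

text \<open>Taking \<open>v_closure\<close> in \<open>A \<subseteq> star A\<close> gives the
  inclusion missing from \<open>star_operation_subset_v_closure\<close>.\<close>

lemma star_operation_eq_v_closure:
  assumes "star_operation star" "A \<in> fractional_ideals" "v_closure (star A) = star A"
  shows "star A = v_closure A"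
proof
  have "A \<subseteq> star A" using assms(1,2) by (simp add: star_operation_def)
  then show "v_closure A \<subseteq> star A" using v_closure_mono assms(3) by metis
qed (rule star_operation_subset_v_closure[OF assms(1,2)])

lemma v_closure_v_finite_type: "v_finite_type A \<Longrightarrow> v_closure A = A"
  by (auto simp: v_finite_type_iff v_closure_idem)

lemma v_closure_finite_intersection_of_principals:
  "finite_intersection_of_principals A \<Longrightarrow> v_closure A = A"
  by (auto simp: finite_intersection_of_principals_iff)

section \<open>The equivalences\<close>

theorem theorem3p1:
  assumes "(base_ring :: 'a::idom fract set) \<noteq> UNIV"
  shows
    "(dually_compact TYPE('a) \<longleftrightarrow>
        (\<forall>A \<in> (fractional_ideals :: 'a fract set set). v_finite_type (v_closure A))) \<and>
     (dually_compact TYPE('a) \<longleftrightarrow>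
        (\<forall>A \<in> (fractional_ideals :: 'a fract set set). v_finite_type (ideal_inverse A))) \<and>
     (dually_compact TYPE('a) \<longleftrightarrow>
        (\<forall>A \<in> (integral_ideals :: 'a fract set set). v_finite_type (ideal_inverse A))) \<and>
     (dually_compact TYPE('a) \<longleftrightarrow>
        (\<forall>A \<in> (integral_ideals :: 'a fract set set). v_finite_type (v_closure A))) \<and>
     (dually_compact TYPE('a) \<longleftrightarrow>
        (\<forall>A :: 'a fract set. divisorial A \<longrightarrow> finite_intersection_of_principals A)) \<and>
     (dually_compact TYPE('a) \<longleftrightarrow>
        (\<exists>star :: 'a fract set \<Rightarrow> 'a fract set. star_operation star \<and>
           (\<forall>A \<in> fractional_ideals. v_finite_type (star A)))) \<and>
     (dually_compact TYPE('a) \<longleftrightarrow>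
        (\<exists>star :: 'a fract set \<Rightarrow> 'a fract set. star_operation star \<and>
           (\<forall>A \<in> fractional_ideals. finite_intersection_of_principals (star A))))"
proof -
  let ?F = "fractional_ideals :: 'a fract set set"
  let ?I = "integral_ideals :: 'a fract set set"
  let ?fip = "finite_intersection_of_principals :: 'a fract set \<Rightarrow> bool"
  let ?DC = "dually_compact TYPE('a)"
  \<comment> \<open>Inverses and \<open>v\<close>-closures of fractional ideals form the same
    family: \<open>v_closure A\<close> is the inverse of \<open>ideal_inverse A\<close>, and each
    inverse is its own \<open>v\<close>-closure.\<close>
  have DC_v: "?DC \<longleftrightarrow> (\<forall>A\<in>?F. ?fip (v_closure A))"
    unfolding dually_compact_iff
    by (metis ideal_inverse_in_fractional_ideals v_closure_def v_closure_ideal_inverse)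
  have integral_inverse: "(\<forall>A\<in>?I. ?fip (ideal_inverse A)) \<longleftrightarrow> (\<forall>A\<in>?F. ?fip (ideal_inverse A))"
  proof (intro iffI ballI)
    fix A assume fip: "\<forall>A\<in>?I. ?fip (ideal_inverse A)" and "A \<in> ?F"
    then obtain d where "d \<noteq> 0" "(*) (to_fract d) ` A \<in> integral_ideals"
      using scale_fractional_ideal_integral by blast
    with bspec[OF fip this(2)] show "?fip (ideal_inverse A)"
      by (simp add: ideal_inverse_scale finite_intersection_of_principals_scale_iff)
  qed (use integral_ideals_subset in blast)
  have integral_v: "(\<forall>A\<in>?I. ?fip (v_closure A)) \<longleftrightarrow> (\<forall>A\<in>?F. ?fip (v_closure A))"
  proof (intro iffI ballI)
    fix A assume fip: "\<forall>A\<in>?I. ?fip (v_closure A)" and "A \<in> ?F"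
    then obtain d where "d \<noteq> 0" "(*) (to_fract d) ` A \<in> integral_ideals"
      using scale_fractional_ideal_integral by blast
    with bspec[OF fip this(2)] show "?fip (v_closure A)"
      by (simp add: v_closure_scale finite_intersection_of_principals_scale_iff)
  qed (use integral_ideals_subset in blast)
  have 2: "?DC \<longleftrightarrow> (\<forall>A\<in>?F. v_finite_type (v_closure A))"
    by (simp add: dually_compact_iff v_finite_type_v_closure_iff)
  have 3: "?DC \<longleftrightarrow> (\<forall>A\<in>?F. v_finite_type (ideal_inverse A))"
    by (simp add: DC_v v_finite_type_ideal_inverse_iff)
  \<comment> \<open>Finite type of \<open>ideal_inverse A\<close> is a condition on
    \<open>v_closure A\<close>, and vice versa. Hence (4) reduces to integral ideals through
    \<open>integral_v\<close> and (5) through \<open>integral_inverse\<close>.\<close>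
  have 4: "?DC \<longleftrightarrow> (\<forall>A\<in>?I. v_finite_type (ideal_inverse A))"
    using integral_ideals_subset v_finite_type_ideal_inverse_iff
    unfolding DC_v integral_v[symmetric] by blast
  have 5: "?DC \<longleftrightarrow> (\<forall>A\<in>?I. v_finite_type (v_closure A))"
    using integral_ideals_subset v_finite_type_v_closure_iff
    unfolding dually_compact_iff integral_inverse[symmetric] by blast
  \<comment> \<open>The divisorial ideals are exactly the \<open>v\<close>-closures of fractional
    ideals.\<close>
  have 6: "?DC \<longleftrightarrow> (\<forall>A. divisorial A \<longrightarrow> ?fip A)"
    unfolding DC_v divisorial_def
    by (metis v_closure_idem v_closure_in_fractional_ideals)
  \<comment> \<open>The witness is \<open>v_closure\<close>. Conversely, values of finite type are
    divisorial, which forces \<open>star\<close> to agree with \<open>v_closure\<close> on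
    fractional ideals; (8) follows the same pattern.\<close>
  have 7: "?DC \<longleftrightarrow> (\<exists>star. star_operation star \<and> (\<forall>A\<in>?F. v_finite_type (star A)))"
    unfolding 2
    by (metis star_operation_v_closure star_operation_eq_v_closure v_closure_v_finite_type)
  have 8: "?DC \<longleftrightarrow> (\<exists>star. star_operation star \<and> (\<forall>A\<in>?F. ?fip (star A)))"
    unfolding DC_v
    by (metis star_operation_v_closure star_operation_eq_v_closure
        v_closure_finite_intersection_of_principals)
  show ?thesis
    by (intro conjI 2 3 4 5 6 7 8)
qed

end
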